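(* For all $X,Y\in\mathrm{evC}$, $$\mathsf{SS}(\delta(X\mathbin{\square}Y))=\mathsf{SS}(\delta(X))\cdot\mathsf{SS}(\delta(Y)).$$
   Context: $\mathbb{K}$ is an integral domain, $\mathbb{N}=\{1,2,\ldots\}$, $d\in\mathbb{N}$ is fixed; $\mathbb{N}^2$ carries the product order. $\mathrm{evC}$ is the $\mathbb{K}$-module of eventually constant functions $X:\mathbb{N}^2\to\mathbb{K}^d$, i.e. those for which there is $\boldsymbol{n}\in\mathbb{N}^2$ such that $X$ is constant on $\{\boldsymbol{i}\in\mathbb{N}^2\mid\boldsymbol{i}\not\leq\boldsymbol{n}\}$; the least such $\boldsymbol{n}$ is $\mathsf{size}(X)=(\mathsf{rows}(X),\mathsf{cols}(X))$. $\mathrm{evZ}\subseteq\mathrm{evC}$ is the submodule of functions of finite support. For $(a,k)\in\{1,2\}\times\mathbb{N}$, $\mathsf{warp}_{a,k}:\mathrm{evC}\to\mathrm{evC}$ is $(\mathsf{warp}_{a,k}X)_{\boldsymbol{i}}=X_{\boldsymbol{i}}$ if $\boldsymbol{i}_a\leq k$ and $X_{\boldsymbol{i}-e_a}$ if $\boldsymbol{i}_a>k$. The difference operator $\delta:\mathrm{evC}\to\mathrm{evZ}$ is $(\delta X)_{i,j}=X_{i+1,j+1}-X_{i+1,j}-X_{i,j+1}+X_{i,j}$; $\varsigma:\mathrm{evZ}\to\mathrm{evC}$ is $(\varsigma Z)_{i,j}=\sum_{s\geq i}\sum_{t\geq j}Z_{s,t}$; and $\mathrm{NF}_{\ker(\delta)}=\varsigma\circ\delta$.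 Concatenation along the diagonal is $$X\mathbin{\square}Y=\mathrm{NF}_{\ker(\delta)}(X)+\mathsf{warp}_{1,1}^{\mathsf{rows}(X)}\circ\mathsf{warp}_{2,1}^{\mathsf{cols}(X)}(Y)$$ (exponents denote iteration). $(\mathfrak{M}_d,\star,\varepsilon)$ is the free commutative monoid generated by $d$ letters $\mathbf{1},\ldots,\mathbf{d}$. A non-empty matrix composition is a matrix $\mathbf{a}\in\mathfrak{M}_d^{m\times n}$ ($m,n\geq1$) such that no row and no column consists only of entries $\varepsilon$; $\mathrm{Cmp}$ is the set of all these together with the empty composition $\mathsf{e}$. $\mathrm{diag}(\mathbf{a},\mathbf{b})$ is the block diagonal matrix with blocks $\mathbf{a}$, $\mathbf{b}$ and all other entries $\varepsilon$ (blocks need not be square), and $\mathrm{diag}(\mathsf{e},\mathbf{a})=\mathrm{diag}(\mathbf{a},\mathsf{e})=\mathbf{a}$. For $z\in\mathbb{K}^d$, $\lambda\mapsto z^{(\lambda)}$ is the monoid homomorphism from $\mathfrak{M}_d$ to the multiplicative monoid of $\mathbb{K}$ with $z^{(\mathbf{j})}=z_j$. For $Z\in\mathrm{evZ}$, $\mathsf{SS}(Z)$ is the function $\mathrm{Cmp}\to\mathbb{K}$ with $\langle\mathsf{SS}(Z),\mathsf{e}\rangle=1$ and, for $\mathbf{a}$ of size $m\times n$, $$\langle\mathsf{SS}(Z),\mathbf{a}\rangle=\sum_{\substack{1\leq\iota_1<\cdots<\iota_m\\1\leq\kappa_1<\cdots<\kappa_n}}\ \prod_{s=1}^{m}\prod_{t=1}^{n}Z_{\iota_s,\kappa_t}^{(\mathbf{a}_{s,t})}.$$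 Functions $F,G:\mathrm{Cmp}\to\mathbb{K}$ are multiplied by $\langle F\cdot G,\mathbf{a}\rangle=\sum_{\mathrm{diag}(\mathbf{b},\mathbf{c})=\mathbf{a}}\langle F,\mathbf{b}\rangle\langle G,\mathbf{c}\rangle$, summing over all $(\mathbf{b},\mathbf{c})\in\mathrm{Cmp}^2$ with $\mathrm{diag}(\mathbf{b},\mathbf{c})=\mathbf{a}$. *)

theory Defs
  imports
    "HOL-Analysis.Analysis"
    "HOL-Library.Multiset"
    "HOL-Library.FuncSet"
    "HOL-Library.Product_Order"
    "HOL-Library.Product_Plus"
    "Jordan_Normal_Form.Matrix"
begin

text \<open>
  Functions defined on a proper subset of a type (here: the pairs of positive
  integers inside \<^typ>\<open>nat \<times> nat\<close>, and the matrix compositions inside all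
  matrices) are represented as extensional functions, so that HOL equality is equality of
  functions on the intended domain. The order on \<^typ>\<open>nat \<times> nat\<close> is the product order.
  \<open>\<bbbK>\<close> is a type of class \<^class>\<open>idom\<close>, \<open>\<bbbK>\<^sup>d\<close> is
  \<^typ>\<open>'a ^ 'd\<close> for a finite type \<^typ>\<open>'d\<close> of letters, and \<open>\<MM>\<^sub>d\<close>
  is \<^typ>\<open>'d multiset\<close>, with \<open>\<epsilon>\<close> the empty multiset and \<open>\<star>\<close> multiset sum.
  The infinite sums are \<^const>\<open>supp_sum\<close>, the sum over the nonzero summands.
\<close>

definition posN2 :: "(nat \<times> nat) set" where
  "posN2 = {1..} \<times> {1..}"

subsection \<open>Eventually constant functions\<close>

definition const_off :: "nat \<times> nat \<Rightarrow> (nat \<times> nat \<Rightarrow> 'v) \<Rightarrow> bool" where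
  "const_off n X \<longleftrightarrow> (\<exists>c. \<forall>i\<in>posN2. \<not> i \<le> n \<longrightarrow> X i = c)"

definition evC :: "(nat \<times> nat \<Rightarrow> 'a::idom ^ 'd::finite) set" where
  "evC = {X \<in> extensional posN2. \<exists>n\<in>posN2. const_off n X}"

definition evZ :: "(nat \<times> nat \<Rightarrow> 'a::idom ^ 'd::finite) set" where
  "evZ = {Z \<in> extensional posN2. finite {i \<in> posN2. Z i \<noteq> 0}}"

definition ev_size :: "(nat \<times> nat \<Rightarrow> 'v) \<Rightarrow> nat \<times> nat" where
  "ev_size X = (LEAST n. n \<in> posN2 \<and> const_off n X)"

definition rows :: "(nat \<times> nat \<Rightarrow> 'v) \<Rightarrow> nat" where
  "rows X = fst (ev_size X)"

definition cols :: "(nat \<times> nat \<Rightarrow> 'v) \<Rightarrow> nat" where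
  "cols X = snd (ev_size X)"

text \<open>The axis \<open>a\<close> ranges over \<open>{1, 2}\<close>.\<close>

definition coord :: "nat \<Rightarrow> nat \<times> nat \<Rightarrow> nat" where
  "coord a i = (if a = 1 then fst i else snd i)"

definition axis_unit :: "nat \<Rightarrow> nat \<times> nat" where
  "axis_unit a = (if a = 1 then (1, 0) else (0, 1))"

definition warp :: "nat \<Rightarrow> nat \<Rightarrow> (nat \<times> nat \<Rightarrow> 'v) \<Rightarrow> (nat \<times> nat \<Rightarrow> 'v)" where
  "warp a k X = (\<lambda>i\<in>posN2. if coord a i \<le> k then X i else X (i - axis_unit a))"

definition diff_op :: "(nat \<times> nat \<Rightarrow> 'v::ab_group_add) \<Rightarrow> (nat \<times> nat \<Rightarrow> 'v)" (\<open>\<delta>\<close>) where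
  "\<delta> X = (\<lambda>(i, j)\<in>posN2. X (i+1, j+1) - X (i+1, j) - X (i, j+1) + X (i, j))"

definition sum_op :: "(nat \<times> nat \<Rightarrow> 'v::ab_group_add) \<Rightarrow> (nat \<times> nat \<Rightarrow> 'v)" (\<open>\<sigma>\<close>) where
  "\<sigma> Z = (\<lambda>(i, j)\<in>posN2. supp_sum Z ({i..} \<times> {j..}))"

definition NF_ker_delta :: "(nat \<times> nat \<Rightarrow> 'v::ab_group_add) \<Rightarrow> (nat \<times> nat \<Rightarrow> 'v)" where
  "NF_ker_delta = \<sigma> \<circ> \<delta>"

definition diag_concat ::
  "(nat \<times> nat \<Rightarrow> 'v::ab_group_add) \<Rightarrow> (nat \<times> nat \<Rightarrow> 'v) \<Rightarrow> (nat \<times> nat \<Rightarrow> 'v)"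
  (infixl \<open>\<box>\<close> 65) where
  "X \<box> Y =
    (\<lambda>i\<in>posN2. NF_ker_delta X i + ((warp 1 1 ^^ rows X) \<circ> (warp 2 1 ^^ cols X)) Y i)"

subsection \<open>Matrix compositions\<close>

text \<open>
  The empty composition \<open>\<e>\<close> is the \<open>0 \<times> 0\<close> matrix; see
  \<open>diag_empty_cmp\<close> and \<open>SS_empty_cmp\<close> below for the conventions attached to it.
  Matrix entries are indexed from 0.
\<close>

definition empty_cmp :: "'d multiset Matrix.mat" where
  "empty_cmp = 0\<^sub>m 0 0"

definition Cmp :: "'d multiset Matrix.mat set" where
  "Cmp = insert empty_cmp {a. dim_row a \<ge> 1 \<and> dim_col a \<ge> 1 \<and>
     (\<forall>s < dim_row a. \<exists>t < dim_col a. a $$ (s, t) \<noteq> {#}) \<and>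
     (\<forall>t < dim_col a. \<exists>s < dim_row a. a $$ (s, t) \<noteq> {#})}"

text \<open>The zero matrix over \<^typ>\<open>'d multiset\<close> is the matrix with all entries \<open>\<epsilon>\<close>.\<close>

definition cmp_diag ::
  "'d multiset Matrix.mat \<Rightarrow> 'd multiset Matrix.mat \<Rightarrow> 'd multiset Matrix.mat" where
  "cmp_diag a b = four_block_mat
     a (0\<^sub>m (dim_row a) (dim_col b))
     (0\<^sub>m (dim_row b) (dim_col a)) b"

definition vpow :: "'a::idom ^ 'd::finite \<Rightarrow> 'd multiset \<Rightarrow> 'a" where
  "vpow z l = (\<Prod>j\<in>#l. vec_nth z j)"

definition incr_seqs :: "nat \<Rightarrow> nat list set" where
  "incr_seqs m = {u. length u = m \<and> sorted_wrt (<) u \<and> set u \<subseteq> {1..}}"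

definition SS :: "(nat \<times> nat \<Rightarrow> 'a::idom ^ 'd::finite) \<Rightarrow> 'd multiset Matrix.mat \<Rightarrow> 'a" where
  "SS Z = (\<lambda>a\<in>Cmp.
     supp_sum (\<lambda>(u, v). \<Prod>s<dim_row a. \<Prod>t<dim_col a. vpow (Z (u ! s, v ! t)) (a $$ (s, t)))
       (incr_seqs (dim_row a) \<times> incr_seqs (dim_col a)))"

definition cmp_mult ::
  "('d multiset Matrix.mat \<Rightarrow> 'a::idom) \<Rightarrow> ('d multiset Matrix.mat \<Rightarrow> 'a) \<Rightarrow>
   'd multiset Matrix.mat \<Rightarrow> 'a" (infixl \<open>\<bullet>\<^sub>C\<close> 70) where
  "F \<bullet>\<^sub>C G = (\<lambda>a\<in>Cmp. \<Sum>(b, c) \<in> {(b, c) \<in> Cmp \<times> Cmp. cmp_diag b c = a}. F b * G c)"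

subsection \<open>Well-definedness\<close>

lemma ev_size_least:
  assumes "X \<in> evC"
  shows "ev_size X \<in> posN2 \<and> const_off (ev_size X) X \<and>
    (\<forall>n\<in>posN2. const_off n X \<longrightarrow> ev_size X \<le> n)"
proof -
  define P where "P = (\<lambda>n. n \<in> posN2 \<and> const_off n X)"
  have inf: "P (min a1 b1, min a2 b2)" if P1: "P (a1, a2)" and P2: "P (b1, b2)" for a1 a2 b1 b2
  proof -
    obtain c where c: "\<forall>i\<in>posN2. \<not> i \<le> (a1, a2) \<longrightarrow> X i = c"
      using P1 unfolding P_def const_off_def by blast
    obtain c' where c': "\<forall>i\<in>posN2. \<not> i \<le> (b1, b2) \<longrightarrow> X i = c'"
      using P2 unfolding P_def const_off_def by blast
    have w: "(a1 + b1 + 1, 1) \<in> posN2" "\<not> (a1 + b1 + 1, 1) \<le> (a1, a2)"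
      "\<not> (a1 + b1 + 1, 1) \<le> (b1, b2)"
      by (auto simp: posN2_def)
    have "c = c'" using c c' w by metis
    then have "const_off (min a1 b1, min a2 b2) X"
      unfolding const_off_def using c c' by (intro exI[of _ c]) (auto simp: less_eq_prod_def)
    then show ?thesis using P1 P2 by (auto simp: P_def posN2_def)
  qed
  obtain n0 where n0: "P n0" using assms by (auto simp: evC_def P_def)
  define p where "p = (LEAST p. \<exists>q. P (p, q))"
  define q where "q = (LEAST q. \<exists>p. P (p, q))"
  have ex: "\<exists>q. P (fst n0, q)" "\<exists>p. P (p, snd n0)"
    using n0 by (metis prod.collapse)+
  obtain q' where q': "P (p, q')" using LeastI[of "\<lambda>p. \<exists>q. P (p, q)", OF ex(1)] p_def by blast
  obtain p' where p': "P (p', q)" using LeastI[of "\<lambda>q. \<exists>p. P (p, q)", OF ex(2)] q_def by blast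
  have le: "p \<le> x \<and> q \<le> y" if "P (x, y)" for x y
    using that unfolding p_def q_def by (auto intro: Least_le)
  have pq: "P (p, q)" using inf[OF q' p'] le[OF q'] le[OF p'] by (simp add: min_def split: if_splits)
  have "ev_size X = (p, q)"
    unfolding ev_size_def
  proof (rule Least_equality)
    show "(p, q) \<in> posN2 \<and> const_off (p, q) X" using pq by (simp add: P_def)
    show "(p, q) \<le> y" if "y \<in> posN2 \<and> const_off y X" for y
      using le[of "fst y" "snd y"] that by (simp add: P_def less_eq_prod_def)
  qed
  moreover have "(p, q) \<le> n" if "P n" for n
    using le[of "fst n" "snd n"] that by (simp add: less_eq_prod_def)
  ultimately show ?thesis using pq by (auto simp: P_def)
qed

lemma diff_op_evC: "\<delta> X \<in> evZ" if X: "X \<in> evC"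
proof -
  obtain n c where n: "\<forall>i\<in>posN2. \<not> i \<le> n \<longrightarrow> X i = c"
    using X unfolding evC_def const_off_def by blast
  have "{i \<in> posN2. \<delta> X i \<noteq> 0} \<subseteq> {..fst n} \<times> {..snd n}"
  proof
    fix i assume i: "i \<in> {i \<in> posN2. \<delta> X i \<noteq> 0}"
    obtain x y where xy: "i = (x, y)" by force
    show "i \<in> {..fst n} \<times> {..snd n}"
    proof (rule ccontr)
      assume *: "i \<notin> {..fst n} \<times> {..snd n}"
      have X: "X (x + a, y + b) = c" for a b
        using i * by (intro n[rule_format]) (auto simp: xy posN2_def less_eq_prod_def)
      have "\<delta> X i = 0" if "i \<in> posN2"
        using that X[of 0 0] X[of 0 1] X[of 1 0] X[of 1 1] by (simp add: xy diff_op_def)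
      then show False using i by simp
    qed
  qed
  then have "finite {i \<in> posN2. \<delta> X i \<noteq> 0}"
    by (rule finite_subset) simp
  then show ?thesis by (simp add: evZ_def diff_op_def)
qed

lemma empty_cmp_in_Cmp: "empty_cmp \<in> Cmp"
  by (simp add: Cmp_def)

lemma diag_empty_cmp: "cmp_diag empty_cmp a = a" "cmp_diag a empty_cmp = a"
  by (auto simp: cmp_diag_def empty_cmp_def intro!: eq_matI)

lemma SS_empty_cmp: "SS Z empty_cmp = 1"
proof -
  have "incr_seqs 0 = {[]}" by (auto simp: incr_seqs_def)
  then show ?thesis
    by (simp add: SS_def Cmp_def empty_cmp_def supp_sum_def support_on_def if_distrib cong: if_cong)
qed

lemma vpow_hom:
  "vpow z {#} = 1" "vpow z (k + l) = vpow z k * vpow z l" "vpow z {#j#} = vec_nth z j"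
  by (simp_all add: vpow_def)

text \<open>For \<^term>\<open>Z \<in> evZ\<close> only finitely many summands in \<^const>\<open>SS\<close> are nonzero.\<close>

lemma finite_SS_support:
  assumes Z: "Z \<in> evZ" and a: "a \<in> Cmp"
  shows "finite (support_on (incr_seqs (dim_row a) \<times> incr_seqs (dim_col a))
    (\<lambda>(u, v). \<Prod>s<dim_row a. \<Prod>t<dim_col a. vpow (Z (u ! s, v ! t)) (a $$ (s, t))))"
    (is "finite ?S")
proof -
  define F where "F = {i \<in> posN2. Z i \<noteq> 0}"
  have fin: "finite F" using Z by (simp add: evZ_def F_def)
  let ?L = "\<lambda>A m. {u. set u \<subseteq> A \<and> length u = m}"
  have "?S \<subseteq> ?L (fst ` F) (dim_row a) \<times> ?L (snd ` F) (dim_col a)"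
  proof
    fix w assume "w \<in> ?S"
    then obtain u v where w: "w = (u, v)" and uv: "u \<in> incr_seqs (dim_row a)"
      "v \<in> incr_seqs (dim_col a)"
      and nz: "\<And>s t. s < dim_row a \<Longrightarrow> t < dim_col a \<Longrightarrow> vpow (Z (u ! s, v ! t)) (a $$ (s, t)) \<noteq> 0"
      by (auto simp: support_on_def)
    have pos: "u ! s \<ge> 1" "v ! t \<ge> 1" if "s < dim_row a" "t < dim_col a" for s t
      using uv that by (force simp: incr_seqs_def)+
    have F: "(u ! s, v ! t) \<in> F" if "s < dim_row a" "t < dim_col a" "a $$ (s, t) \<noteq> {#}" for s t
    proof -
      have "vpow 0 (a $$ (s, t)) = (0::'a)"
        using that(3) by (cases "a $$ (s, t)") (auto simp: vpow_def)
      then have "Z (u ! s, v ! t) \<noteq> 0" using nz[OF that(1,2)] by metis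
      then show ?thesis using pos[OF that(1,2)] by (simp add: F_def posN2_def)
    qed
    have "u ! s \<in> fst ` F" if "s < dim_row a" for s
    proof -
      have "\<exists>t < dim_col a. a $$ (s, t) \<noteq> {#}"
        using a that by (auto simp: Cmp_def empty_cmp_def)
      then obtain t where "t < dim_col a" "a $$ (s, t) \<noteq> {#}" by blast
      from F[OF that this] show ?thesis by force
    qed
    moreover have "v ! t \<in> snd ` F" if "t < dim_col a" for t
    proof -
      have "\<exists>s < dim_row a. a $$ (s, t) \<noteq> {#}"
        using a that by (auto simp: Cmp_def empty_cmp_def)
      then obtain s where "s < dim_row a" "a $$ (s, t) \<noteq> {#}" by blast
      from F[OF this(1) that this(2)] show ?thesis by force
    qed
    ultimately show "w \<in> ?L (fst ` F) (dim_row a) \<times> ?L (snd ` F) (dim_col a)"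
      using uv by (auto simp: w incr_seqs_def in_set_conv_nth)
  qed
  then show ?thesis
    by (rule finite_subset) (intro finite_cartesian_product finite_lists_length_eq finite_imageI fin)
qed

lemma finite_diag_decompositions: "finite {(b, c) \<in> Cmp \<times> Cmp. cmp_diag b c = a}"
proof -
  let ?D = "{(b, c). cmp_diag b c = a}"
  let ?f = "\<lambda>(b, c). ((dim_row b, dim_col b), (dim_row c, dim_col c))"
  let ?B = "({..dim_row a} \<times> {..dim_col a}) \<times> ({..dim_row a} \<times> {..dim_col a})"
  have "?f ` ?D \<subseteq> ?B" by (auto simp: cmp_diag_def)
  then have "finite (?f ` ?D)" by (rule finite_subset) auto
  moreover have "inj_on ?f ?D"
  proof (rule inj_onI)
    fix p q assume "p \<in> ?D" "q \<in> ?D" and f: "?f p = ?f q"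
    moreover obtain b c b' c' where pq: "p = (b, c)" "q = (b', c')" by fastforce
    ultimately have e: "cmp_diag b c = cmp_diag b' c'"
      and d: "dim_row b = dim_row b'" "dim_col b = dim_col b'"
        "dim_row c = dim_row c'" "dim_col c = dim_col c'"
      by auto
    have "b $$ (s, t) = b' $$ (s, t)" if "s < dim_row b'" "t < dim_col b'" for s t
      using arg_cong[OF e, of "\<lambda>m. m $$ (s, t)"] that d by (simp add: cmp_diag_def)
    moreover have "c $$ (s, t) = c' $$ (s, t)" if "s < dim_row c'" "t < dim_col c'" for s t
      using arg_cong[OF e, of "\<lambda>m. m $$ (dim_row b' + s, dim_col b' + t)"] that d
      by (simp add: cmp_diag_def)
    ultimately show "p = q" using d by (auto simp: pq intro!: eq_matI)
  qed
  ultimately have "finite ?D" by (simp add: finite_image_iff)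
  then show ?thesis by (rule rev_finite_subset) auto
qed

end

theory Submission
  imports Defs
begin

text \<open>
  The identity holds because the difference operator turns concatenation along the diagonal into a
  block diagonal arrangement, and on such an arrangement the sums signature is multiplicative.

  An eventually constant \<open>X\<close> with eventual value \<open>c\<close> has \<open>\<delta> X\<close> supported in its size rectangle
  \<open>p \<times> q\<close>, and telescoping gives that \<open>\<sigma> (\<delta> X)\<close> is \<open>X - c\<close>, so this summand contributes \<open>\<delta> X\<close>
  again. Iterated warping replaces \<open>Y (i, j)\<close> by \<open>Y\<close> at \<open>(max 1 (i - p), max 1 (j - q))\<close>; this repeats the first
  row and the first column of \<open>Y\<close>, so its differences vanish for \<open>i \<le> p\<close> or \<open>j \<le> q\<close> and elsewhere are
  those of \<open>Y\<close>, translated by \<open>(p, q)\<close>. Hence \<open>\<delta> (X \<box> Y)\<close> carries \<open>\<delta> X\<close> and \<open>\<delta> Y\<close> as diagonal blocks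
  (\<open>diff_op_diag_concat\<close>).

  For such a block arrangement, cut each pair of increasing index sequences at \<open>p\<close> and \<open>q\<close>, say after
  \<open>k\<close> row and \<open>l\<close> column indices (\<open>sum_incr_upto_split\<close>). An entry of the composition \<open>a\<close> outside the two
  diagonal blocks of this cut is evaluated at \<open>0\<close>, so the product over all entries vanishes unless all
  those entries are \<open>\<epsilon>\<close>; then \<open>a\<close> is \<open>diag b c\<close> and the product factors
  (\<open>entry_prod_block_sum\<close>). The surviving cuts \<open>(k, l)\<close> are exactly the decompositions of \<open>a\<close> that the
  product of functions on compositions sums over (\<open>cmp_mult_eq_sum_blocks\<close>).
\<close>

section \<open>Differences of a diagonal concatenation\<close>

definition block_sum ::
  "nat \<Rightarrow> nat \<Rightarrow> (nat \<times> nat \<Rightarrow> 'v::zero) \<Rightarrow> (nat \<times> nat \<Rightarrow> 'v) \<Rightarrow> nat \<times> nat \<Rightarrow> 'v" where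
  "block_sum p q A B = (\<lambda>(i, j)\<in>posN2.
     if i \<le> p \<and> j \<le> q then A (i, j) else if p < i \<and> q < j then B (i - p, j - q) else 0)"

text \<open>
  Only positive indices are constrained: an extensional function takes an unspecified value at the
  others.
\<close>

definition supported_upto :: "nat \<Rightarrow> nat \<Rightarrow> (nat \<times> nat \<Rightarrow> 'v::zero) \<Rightarrow> bool" where
  "supported_upto p q Z \<longleftrightarrow> (\<forall>i j. 1 \<le> i \<longrightarrow> 1 \<le> j \<longrightarrow> \<not> (i \<le> p \<and> j \<le> q) \<longrightarrow> Z (i, j) = 0)"

lemma in_posN2_iff [simp]: "(i, j) \<in> posN2 \<longleftrightarrow> 1 \<le> i \<and> 1 \<le> j"
  by (auto simp: posN2_def)

lemma diff_op_apply:
  assumes "1 \<le> i" "1 \<le> j"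
  shows "\<delta> X (i, j) = X (Suc i, Suc j) - X (Suc i, j) - X (i, Suc j) + X (i, j)"
  using assms by (simp add: diff_op_def)

lemma evC_eventual_value:
  assumes "X \<in> evC"
  obtains c where "\<And>i j. 1 \<le> i \<Longrightarrow> 1 \<le> j \<Longrightarrow> \<not> (i \<le> rows X \<and> j \<le> cols X) \<Longrightarrow> X (i, j) = c"
proof -
  have "const_off (rows X, cols X) X"
    using ev_size_least[OF assms] by (simp add: rows_def cols_def)
  then show ?thesis
    using that unfolding const_off_def by (metis Pair_le in_posN2_iff)
qed

lemma diff_op_supported_upto:
  assumes "X \<in> evC"
  shows "supported_upto (rows X) (cols X) (\<delta> X)"
proof -
  obtain c where c: "\<And>i j. 1 \<le> i \<Longrightarrow> 1 \<le> j \<Longrightarrow> \<not> (i \<le> rows X \<and> j \<le> cols X) \<Longrightarrow> X (i, j) = c"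
    using evC_eventual_value[OF assms] by blast
  show ?thesis
    unfolding supported_upto_def
  proof (intro allI impI)
    fix i j assume ij: "1 \<le> i" "1 \<le> j" "\<not> (i \<le> rows X \<and> j \<le> cols X)"
    have "X (i, j) = c" "X (Suc i, j) = c" "X (i, Suc j) = c" "X (Suc i, Suc j) = c"
      using ij by (auto intro!: c)
    then show "\<delta> X (i, j) = 0"
      using ij by (simp add: diff_op_apply)
  qed
qed

lemma supp_sum_eq_sum:
  assumes "finite T" "T \<subseteq> S" "\<And>x. x \<in> S - T \<Longrightarrow> f x = 0"
  shows "supp_sum f S = sum f T"
  unfolding supp_sum_def
  by (rule sum.mono_neutral_left) (use assms in \<open>auto simp: support_on_def\<close>)

text \<open>Telescoping in both directions leaves the alternating sum over the four corners.\<close>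

lemma sum_diff_op_rectangle:
  assumes "1 \<le> i" "1 \<le> j" "i \<le> P" "j \<le> Q"
  shows "sum (\<delta> X) ({i..<P} \<times> {j..<Q}) = X (P, Q) - X (P, j) - X (i, Q) + X (i, j)"
proof -
  have "sum (\<delta> X) ({i..<P} \<times> {j..<Q}) = (\<Sum>s=i..<P. \<Sum>t=j..<Q. \<delta> X (s, t))"
    by (simp add: sum.cartesian_product)
  also have "\<dots> = (\<Sum>s=i..<P. \<Sum>t=j..<Q. (X (Suc s, Suc t) - X (s, Suc t)) - (X (Suc s, t) - X (s, t)))"
    using assms by (intro sum.cong refl) (simp add: diff_op_apply)
  also have "\<dots> = (\<Sum>s=i..<P. (X (Suc s, Q) - X (s, Q)) - (X (Suc s, j) - X (s, j)))"
    using assms by (intro sum.cong refl sum_Suc_diff'[where f = "\<lambda>t. X (Suc _, t) - X (_, t)"])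
  also have "\<dots> = (X (P, Q) - X (i, Q)) - (X (P, j) - X (i, j))"
    using assms by (simp only: sum_subtractf[of "\<lambda>s. X (Suc s, Q) - X (s, Q)"]
        sum_Suc_diff'[where f = "\<lambda>s. X (s, Q)"] sum_Suc_diff'[where f = "\<lambda>s. X (s, j)"])
  finally show ?thesis by simp
qed

text \<open>
  Summation inverts the difference operator up to the eventual value: in a rectangle reaching
  beyond the size of \<open>X\<close>, three of the four corners carry that value.
\<close>

lemma NF_ker_delta_evC:
  assumes "X \<in> evC"
  obtains c where "\<And>i j. 1 \<le> i \<Longrightarrow> 1 \<le> j \<Longrightarrow> NF_ker_delta X (i, j) = X (i, j) - c"
proof -
  obtain c where c: "\<And>i j. 1 \<le> i \<Longrightarrow> 1 \<le> j \<Longrightarrow> \<not> (i \<le> rows X \<and> j \<le> cols X) \<Longrightarrow> X (i, j) = c"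
    using evC_eventual_value[OF assms] by blast
  have "NF_ker_delta X (i, j) = X (i, j) - c" if ij: "1 \<le> i" "1 \<le> j" for i j
  proof -
    define P Q where "P = i + rows X + 1" and "Q = j + cols X + 1"
    have "NF_ker_delta X (i, j) = supp_sum (\<delta> X) ({i..} \<times> {j..})"
      using ij by (simp add: NF_ker_delta_def sum_op_def)
    also have "\<dots> = sum (\<delta> X) ({i..<P} \<times> {j..<Q})"
    proof (rule supp_sum_eq_sum)
      fix w assume w: "w \<in> {i..} \<times> {j..} - {i..<P} \<times> {j..<Q}"
      obtain s t where st: "w = (s, t)" by force
      have "1 \<le> s" "1 \<le> t" "\<not> (s \<le> rows X \<and> t \<le> cols X)"
        using w ij by (auto simp: st P_def Q_def)
      then show "\<delta> X w = 0"
        using diff_op_supported_upto[OF assms] by (simp add: supported_upto_def st)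
    qed auto
    also have "\<dots> = X (P, Q) - X (P, j) - X (i, Q) + X (i, j)"
      using ij by (intro sum_diff_op_rectangle) (auto simp: P_def Q_def)
    also have "\<dots> = X (i, j) - c"
      using c[of P Q] c[of P j] c[of i Q] ij by (simp add: P_def Q_def)
    finally show ?thesis .
  qed
  then show ?thesis by (rule that)
qed

lemma warp_first_apply:
  assumes "1 \<le> i" "1 \<le> j"
  shows "warp 1 1 Y (i, j) = (if i \<le> 1 then Y (i, j) else Y (i - 1, j))"
    and "warp 2 1 Y (i, j) = (if j \<le> 1 then Y (i, j) else Y (i, j - 1))"
  using assms by (simp_all add: warp_def coord_def axis_unit_def)

text \<open>
  Each warp at index 1 duplicates the first row (or column), so iterating it shifts the array and
  clamps the shifted index at 1.
\<close>

lemma warp_rows_iter: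
  assumes "1 \<le> i" "1 \<le> j"
  shows "(warp 1 1 ^^ p) Y (i, j) = Y (max 1 (i - p), j)"
  using assms
proof (induction p arbitrary: i)
  case (Suc p)
  have "(warp 1 1 ^^ Suc p) Y (i, j) =
      (if i \<le> 1 then (warp 1 1 ^^ p) Y (i, j) else (warp 1 1 ^^ p) Y (i - 1, j))"
    by (simp only: funpow.simps o_apply warp_first_apply(1)[OF Suc.prems])
  also have "\<dots> = (if i \<le> 1 then Y (max 1 (i - p), j) else Y (max 1 (i - 1 - p), j))"
    using Suc.IH[of i] Suc.IH[of "i - 1"] Suc.prems by auto
  also have "\<dots> = Y (if i \<le> 1 then max 1 (i - p) else max 1 (i - 1 - p), j)"
    by simp
  also have "(if i \<le> 1 then max 1 (i - p) else max 1 (i - 1 - p)) = max 1 (i - Suc p)"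
    using Suc.prems by auto
  finally show ?case .
qed (simp add: max_def)

lemma warp_cols_iter:
  assumes "1 \<le> i" "1 \<le> j"
  shows "(warp 2 1 ^^ q) Y (i, j) = Y (i, max 1 (j - q))"
  using assms
proof (induction q arbitrary: j)
  case (Suc q)
  have "(warp 2 1 ^^ Suc q) Y (i, j) =
      (if j \<le> 1 then (warp 2 1 ^^ q) Y (i, j) else (warp 2 1 ^^ q) Y (i, j - 1))"
    by (simp only: funpow.simps o_apply warp_first_apply(2)[OF Suc.prems])
  also have "\<dots> = (if j \<le> 1 then Y (i, max 1 (j - q)) else Y (i, max 1 (j - 1 - q)))"
    using Suc.IH[of j] Suc.IH[of "j - 1"] Suc.prems by auto
  also have "\<dots> = Y (i, if j \<le> 1 then max 1 (j - q) else max 1 (j - 1 - q))"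
    by simp
  also have "(if j \<le> 1 then max 1 (j - q) else max 1 (j - 1 - q)) = max 1 (j - Suc q)"
    using Suc.prems by auto
  finally show ?case .
qed (simp add: max_def)

text \<open>
  The normal form of \<open>X\<close> differs from \<open>X\<close> by a constant and has the same differences; the warped
  \<open>Y\<close> does not change from row \<open>i\<close> to row \<open>i + 1\<close> as long as \<open>i \<le> rows X\<close>, and likewise for
  columns.
\<close>

lemma diff_op_diag_concat:
  assumes "X \<in> evC"
  shows "\<delta> (X \<box> Y) = block_sum (rows X) (cols X) (\<delta> X) (\<delta> Y)"
proof
  fix w :: "nat \<times> nat"
  obtain i j where w: "w = (i, j)" by force
  let ?p = "rows X" and ?q = "cols X"
  show "\<delta> (X \<box> Y) w = block_sum ?p ?q (\<delta> X) (\<delta> Y) w"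
  proof (cases "w \<in> posN2")
    case False
    then show ?thesis by (simp add: diff_op_def block_sum_def)
  next
    case True
    then have ij: "1 \<le> i" "1 \<le> j" by (simp_all add: w)
    obtain c where c: "\<And>i j. 1 \<le> i \<Longrightarrow> 1 \<le> j \<Longrightarrow> NF_ker_delta X (i, j) = X (i, j) - c"
      using NF_ker_delta_evC[OF assms] by blast
    have box: "(X \<box> Y) (s, t) = X (s, t) - c + Y (max 1 (s - ?p), max 1 (t - ?q))"
      if "1 \<le> s" "1 \<le> t" for s t
    proof -
      have "((warp 1 1 ^^ ?p) \<circ> (warp 2 1 ^^ ?q)) Y (s, t) = Y (max 1 (s - ?p), max 1 (t - ?q))"
        using that by (simp add: warp_rows_iter warp_cols_iter del: One_nat_def)
      then show ?thesis using that c[OF that] by (simp add: diag_concat_def)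
    qed
    \<comment> \<open>\<open>V\<close> is the warped \<open>Y\<close>; in \<open>\<delta> (X \<box> Y)\<close> the constant \<open>c\<close> cancels.\<close>
    define V where "V s t = Y (max 1 (s - ?p), max 1 (t - ?q))" for s t
    have eq: "\<delta> (X \<box> Y) (i, j) =
        \<delta> X (i, j) + (V (Suc i) (Suc j) - V (Suc i) j - V i (Suc j) + V i j)"
      using ij by (simp add: diff_op_apply box V_def)
    have row: "V (Suc i) t = V i t" if "i \<le> ?p" for t
    proof -
      have "max 1 (Suc i - ?p) = max 1 (i - ?p)" using that by simp
      then show ?thesis by (simp only: V_def)
    qed
    have col: "V s (Suc j) = V s j" if "j \<le> ?q" for s
    proof -
      have "max 1 (Suc j - ?q) = max 1 (j - ?q)" using that by simp
      then show ?thesis by (simp only: V_def)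
    qed
    have sup: "\<delta> X (i, j) = 0" if "\<not> (i \<le> ?p \<and> j \<le> ?q)"
      using diff_op_supported_upto[OF assms] ij that by (simp add: supported_upto_def)
    consider "i \<le> ?p" | "j \<le> ?q" | "?p < i" "?q < j" by linarith
    then show ?thesis
    proof cases
      case 1
      then show ?thesis using eq row sup ij by (simp add: w block_sum_def)
    next
      case 2
      then show ?thesis using eq col sup ij by (simp add: w block_sum_def)
    next
      case 3
      then have "1 \<le> i - ?p" "1 \<le> j - ?q" "Suc i - ?p = Suc (i - ?p)" "Suc j - ?q = Suc (j - ?q)"
        by auto
      then have "V (Suc i) (Suc j) - V (Suc i) j - V i (Suc j) + V i j = \<delta> Y (i - ?p, j - ?q)"
        by (simp add: V_def diff_op_apply max_def)
      then show ?thesis using 3 eq sup ij by (simp add: w block_sum_def)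
    qed
  qed
qed

section \<open>Increasing sequences with bounded entries\<close>

definition incr_upto :: "nat \<Rightarrow> nat \<Rightarrow> nat list set" where
  "incr_upto N m = {u \<in> incr_seqs m. set u \<subseteq> {..N}}"

lemma finite_incr_upto [simp]: "finite (incr_upto N m)"
  by (rule finite_subset[OF _ finite_lists_length_eq[of "{..N}" m]])
    (auto simp: incr_upto_def incr_seqs_def)

lemma incr_upto_nth:
  assumes "u \<in> incr_upto N m" "s < m"
  shows "1 \<le> u ! s" "u ! s \<le> N"
  using assms nth_mem[of s u] by (auto simp: incr_upto_def incr_seqs_def subset_iff)

lemma length_incr_upto: "u \<in> incr_upto N m \<Longrightarrow> length u = m"
  by (simp add: incr_upto_def incr_seqs_def)

text \<open>
  An increasing sequence consists of its entries at most \<open>p\<close> followed by its entries above \<open>p\<close>, and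
  the latter, lowered by \<open>p\<close>, again form an increasing sequence of positive integers.
\<close>

lemma sum_incr_upto_split:
  "sum f (incr_upto (p + p') m) =
    (\<Sum>k\<le>m. \<Sum>u\<in>incr_upto p k. \<Sum>u'\<in>incr_upto p' (m - k). f (u @ map (\<lambda>i. p + i) u'))"
proof -
  have "sum f (incr_upto (p + p') m) =
    (\<Sum>(k, u, u') \<in> (SIGMA k:{..m}. incr_upto p k \<times> incr_upto p' (m - k)).
      f (u @ map (\<lambda>i. p + i) u'))"
  proof (rule sum.reindex_bij_witness[where
        j = "\<lambda>w. (length (filter (\<lambda>x. x \<le> p) w), filter (\<lambda>x. x \<le> p) w,
                  map (\<lambda>x. x - p) (filter (\<lambda>x. \<not> x \<le> p) w))" and
        i = "\<lambda>(k, u, u'). u @ map (\<lambda>i. p + i) u'"])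
    fix w assume w: "w \<in> incr_upto (p + p') m"
    have "filter (\<lambda>x. x \<le> p) w @ filter (\<lambda>x. \<not> x \<le> p) w = w"
      if "sorted_wrt (<) w" for w :: "nat list"
      using that
    proof (induction w)
      case (Cons x w)
      show ?case
      proof (cases "x \<le> p")
        case True
        then show ?thesis using Cons by simp
      next
        case False
        then have "\<forall>y\<in>set w. \<not> y \<le> p" using Cons.prems by auto
        then have "filter (\<lambda>x. x \<le> p) w = []" "filter (\<lambda>x. \<not> x \<le> p) w = w"
          by (auto simp: filter_empty_conv filter_id_conv)
        then show ?thesis using False by simp
      qed
    qed simp
    moreover have sw: "sorted_wrt (<) w" using w by (simp add: incr_upto_def incr_seqs_def)
    ultimately have split: "filter (\<lambda>x. x \<le> p) w @ filter (\<lambda>x. \<not> x \<le> p) w = w" by blast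
    have shift: "map (\<lambda>i. p + i) (map (\<lambda>x. x - p) (filter (\<lambda>x. \<not> x \<le> p) w)) =
        filter (\<lambda>x. \<not> x \<le> p) w"
      unfolding map_map by (rule map_idI) simp
    show "(case (length (filter (\<lambda>x. x \<le> p) w), filter (\<lambda>x. x \<le> p) w,
                  map (\<lambda>x. x - p) (filter (\<lambda>x. \<not> x \<le> p) w)) of
        (k, u, u') \<Rightarrow> u @ map (\<lambda>i. p + i) u') = w"
      using split shift by simp
    show "(case (length (filter (\<lambda>x. x \<le> p) w), filter (\<lambda>x. x \<le> p) w,
                  map (\<lambda>x. x - p) (filter (\<lambda>x. \<not> x \<le> p) w)) of
        (k, u, u') \<Rightarrow> f (u @ map (\<lambda>i. p + i) u')) = f w"
      using split shift by simp
    have len: "length (filter (\<lambda>x. x \<le> p) w) + length (filter (\<lambda>x. \<not> x \<le> p) w) = m"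
      using w sum_length_filter_compl[of "\<lambda>x. x \<le> p" w] by (simp add: length_incr_upto)
    have "sorted_wrt (<) (map (\<lambda>x. x - p) (filter (\<lambda>x. \<not> x \<le> p) w))"
      unfolding sorted_wrt_map
      by (rule sorted_wrt_mono_rel[OF _ sorted_wrt_filter[OF sw]]) auto
    moreover have "sorted_wrt (<) (filter (\<lambda>x. x \<le> p) w)"
      by (rule sorted_wrt_filter[OF sw])
    ultimately show "(length (filter (\<lambda>x. x \<le> p) w), filter (\<lambda>x. x \<le> p) w,
                  map (\<lambda>x. x - p) (filter (\<lambda>x. \<not> x \<le> p) w))
        \<in> (SIGMA k:{..m}. incr_upto p k \<times> incr_upto p' (m - k))"
      using w len by (auto simp: incr_upto_def incr_seqs_def subset_iff)
  next
    fix x assume x: "x \<in> (SIGMA k:{..m}. incr_upto p k \<times> incr_upto p' (m - k))"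
    obtain k u u' where x_eq: "x = (k, u, u')" by (cases x) auto
    have u: "u \<in> incr_upto p k" "u' \<in> incr_upto p' (m - k)" "k \<le> m" using x by (auto simp: x_eq)
    have f1: "filter (\<lambda>x. x \<le> p) u = u" "filter (\<lambda>x. \<not> x \<le> p) u = []"
      using u(1) by (auto simp: incr_upto_def filter_id_conv filter_empty_conv)
    have f2: "filter (\<lambda>x. x \<le> p) (map (\<lambda>i. p + i) u') = []"
      "filter (\<lambda>x. \<not> x \<le> p) (map (\<lambda>i. p + i) u') = map (\<lambda>i. p + i) u'"
      using u(2) by (auto simp: incr_upto_def incr_seqs_def filter_id_conv filter_empty_conv)
    show "(case x of (k, u, u') \<Rightarrow> u @ map (\<lambda>i. p + i) u') \<in> incr_upto (p + p') m"
      using u by (force simp: x_eq incr_upto_def incr_seqs_def sorted_wrt_append sorted_wrt_map)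
    show "(length (filter (\<lambda>x. x \<le> p) (case x of (k, u, u') \<Rightarrow> u @ map (\<lambda>i. p + i) u')),
           filter (\<lambda>x. x \<le> p) (case x of (k, u, u') \<Rightarrow> u @ map (\<lambda>i. p + i) u'),
           map (\<lambda>x. x - p) (filter (\<lambda>x. \<not> x \<le> p)
             (case x of (k, u, u') \<Rightarrow> u @ map (\<lambda>i. p + i) u'))) = x"
      unfolding x_eq prod.case filter_append f1 f2
      using length_incr_upto[OF u(1)] by (simp add: o_def)
  qed
  then show ?thesis
    by (simp add: sum.Sigma[symmetric])
qed

section \<open>Cutting a composition into diagonal blocks\<close>

definition upper_left :: "nat \<Rightarrow> nat \<Rightarrow> 'b Matrix.mat \<Rightarrow> 'b Matrix.mat" where
  "upper_left k l a = Matrix.mat k l (\<lambda>(s, t). a $$ (s, t))"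

definition lower_right :: "nat \<Rightarrow> nat \<Rightarrow> 'b Matrix.mat \<Rightarrow> 'b Matrix.mat" where
  "lower_right k l a = Matrix.mat (dim_row a - k) (dim_col a - l) (\<lambda>(s, t). a $$ (k + s, l + t))"

text \<open>
  The bounds on \<open>k\<close> and \<open>l\<close> make the cuts of a given composition a finite set; both degenerate cuts,
  \<open>(0, 0)\<close> and the full dimensions, are allowed and yield the decompositions with an empty factor.
\<close>

definition off_diag_empty :: "nat \<Rightarrow> nat \<Rightarrow> 'd multiset Matrix.mat \<Rightarrow> bool" where
  "off_diag_empty k l a \<longleftrightarrow> k \<le> dim_row a \<and> l \<le> dim_col a \<and>
    (\<forall>s<dim_row a. \<forall>t<dim_col a. (s < k) \<noteq> (t < l) \<longrightarrow> a $$ (s, t) = {#})"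

lemma dim_blocks [simp]:
  "dim_row (upper_left k l a) = k" "dim_col (upper_left k l a) = l"
  "dim_row (lower_right k l a) = dim_row a - k" "dim_col (lower_right k l a) = dim_col a - l"
  by (simp_all add: upper_left_def lower_right_def)

text \<open>
  The empty composition needs no separate case: a matrix without empty rows and columns that has
  one dimension \<open>0\<close> has both dimensions \<open>0\<close>.
\<close>

lemma Cmp_iff:
  "a \<in> Cmp \<longleftrightarrow> (\<forall>s < dim_row a. \<exists>t < dim_col a. a $$ (s, t) \<noteq> {#}) \<and>
     (\<forall>t < dim_col a. \<exists>s < dim_row a. a $$ (s, t) \<noteq> {#})" (is "_ \<longleftrightarrow> ?R")
proof
  assume "a \<in> Cmp"
  then show ?R by (auto simp: Cmp_def empty_cmp_def)
next
  assume R: ?R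
  have "dim_row a = 0 \<longleftrightarrow> dim_col a = 0"
    using R by (metis not_less0 neq0_conv)
  then have "a = empty_cmp \<or> dim_row a \<ge> 1 \<and> dim_col a \<ge> 1"
    by (auto simp: empty_cmp_def intro!: eq_matI)
  then show "a \<in> Cmp" using R by (auto simp: Cmp_def)
qed

lemma cmp_diag_blocks:
  assumes "off_diag_empty k l a"
  shows "cmp_diag (upper_left k l a) (lower_right k l a) = a"
  using assms
  by (intro eq_matI) (auto simp: cmp_diag_def off_diag_empty_def upper_left_def lower_right_def)

text \<open>
  Every row and column of \<open>a\<close> has a nonempty entry, which the cut forces into a diagonal block. In
  particular a block cannot have exactly one dimension equal to \<open>0\<close>.
\<close>

lemma blocks_in_Cmp:
  assumes a: "a \<in> Cmp" and D: "off_diag_empty k l a"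
  shows "upper_left k l a \<in> Cmp" "lower_right k l a \<in> Cmp"
proof -
  have kl: "k \<le> dim_row a" "l \<le> dim_col a" using D by (auto simp: off_diag_empty_def)
  have same: "(s < k) = (t < l)" if "a $$ (s, t) \<noteq> {#}" "s < dim_row a" "t < dim_col a" for s t
    using D that by (auto simp: off_diag_empty_def)
  have row: "\<exists>t<dim_col a. a $$ (s, t) \<noteq> {#} \<and> (s < k) = (t < l)" if "s < dim_row a" for s
  proof -
    have "\<exists>t<dim_col a. a $$ (s, t) \<noteq> {#}" using a that unfolding Cmp_iff by blast
    then obtain t where t: "t < dim_col a" "a $$ (s, t) \<noteq> {#}" by blast
    show ?thesis using t same[OF t(2) that t(1)] by blast
  qed
  have col: "\<exists>s<dim_row a. a $$ (s, t) \<noteq> {#} \<and> (s < k) = (t < l)" if "t < dim_col a" for t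
  proof -
    have "\<exists>s<dim_row a. a $$ (s, t) \<noteq> {#}" using a that unfolding Cmp_iff by blast
    then obtain s where s: "s < dim_row a" "a $$ (s, t) \<noteq> {#}" by blast
    show ?thesis using s same[OF s(2) s(1) that] by blast
  qed
  show "upper_left k l a \<in> Cmp"
    unfolding Cmp_iff dim_blocks
  proof (intro conjI allI impI)
    fix s assume s: "s < k"
    then have "s < dim_row a" using kl by linarith
    from row[OF this] s obtain t where "t < l" "a $$ (s, t) \<noteq> {#}" by blast
    then show "\<exists>t<l. upper_left k l a $$ (s, t) \<noteq> {#}"
      using s by (intro exI[of _ t]) (simp add: upper_left_def)
  next
    fix t assume t: "t < l"
    then have "t < dim_col a" using kl by linarith
    from col[OF this] t obtain s where "s < k" "a $$ (s, t) \<noteq> {#}" by blast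
    then show "\<exists>s<k. upper_left k l a $$ (s, t) \<noteq> {#}"
      using t by (intro exI[of _ s]) (simp add: upper_left_def)
  qed
  show "lower_right k l a \<in> Cmp"
    unfolding Cmp_iff dim_blocks
  proof (intro conjI allI impI)
    fix s assume s: "s < dim_row a - k"
    then have "k + s < dim_row a" by linarith
    from row[OF this] obtain t where "t < dim_col a" "a $$ (k + s, t) \<noteq> {#}" "\<not> t < l"
      by (metis not_add_less1)
    then show "\<exists>t<dim_col a - l. lower_right k l a $$ (s, t) \<noteq> {#}"
      using s by (intro exI[of _ "t - l"]) (auto simp: lower_right_def)
  next
    fix t assume t: "t < dim_col a - l"
    then have "l + t < dim_col a" by linarith
    from col[OF this] obtain s where "s < dim_row a" "a $$ (s, l + t) \<noteq> {#}" "\<not> s < k"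
      by (metis not_add_less1)
    then show "\<exists>s<dim_row a - k. lower_right k l a $$ (s, t) \<noteq> {#}"
      using t by (intro exI[of _ "s - k"]) (auto simp: lower_right_def)
  qed
qed

lemma blocks_of_cmp_diag:
  "off_diag_empty (dim_row b) (dim_col b) (cmp_diag b c)"
  "upper_left (dim_row b) (dim_col b) (cmp_diag b c) = b"
  "lower_right (dim_row b) (dim_col b) (cmp_diag b c) = c"
  by (auto simp: off_diag_empty_def upper_left_def lower_right_def cmp_diag_def intro!: eq_matI)

text \<open>
  A decomposition \<open>a = diag b c\<close> is determined by the dimensions of \<open>b\<close>, so the decompositions may be
  indexed by the admissible cuts.
\<close>

lemma cmp_mult_eq_sum_blocks:
  assumes "a \<in> Cmp"
  shows "(F \<bullet>\<^sub>C G) a = (\<Sum>(k, l) \<in> {(k, l). off_diag_empty k l a}.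
    F (upper_left k l a) * G (lower_right k l a))"
proof -
  have "(F \<bullet>\<^sub>C G) a = (\<Sum>(b, c) \<in> {(b, c) \<in> Cmp \<times> Cmp. cmp_diag b c = a}. F b * G c)"
    using assms by (simp add: cmp_mult_def)
  also have "\<dots> = (\<Sum>(k, l) \<in> {(k, l). off_diag_empty k l a}.
      F (upper_left k l a) * G (lower_right k l a))"
    by (rule sum.reindex_bij_witness[where
          i = "\<lambda>(k, l). (upper_left k l a, lower_right k l a)" and
          j = "\<lambda>(b, c). (dim_row b, dim_col b)"])
      (auto simp: cmp_diag_blocks blocks_in_Cmp[OF assms] blocks_of_cmp_diag)
  finally show ?thesis .
qed

section \<open>Sums signatures of block arrangements\<close>

definition entry_prod ::
  "(nat \<times> nat \<Rightarrow> 'a::idom ^ 'd::finite) \<Rightarrow> 'd multiset Matrix.mat \<Rightarrow> nat list \<Rightarrow> nat list \<Rightarrow> 'a" where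
  "entry_prod Z a u v = (\<Prod>s<dim_row a. \<Prod>t<dim_col a. vpow (Z (u ! s, v ! t)) (a $$ (s, t)))"

lemma vpow_zero: "l \<noteq> {#} \<Longrightarrow> vpow 0 l = 0"
  by (cases l) (auto simp: vpow_def)

text \<open>
  An index outside the support rectangle kills the whole product, because the row or column of \<open>a\<close>
  that it serves contains a nonempty entry. For compositions the range of the indices can therefore
  be bounded independently of \<open>a\<close>.
\<close>

lemma SS_eq_finite_sum:
  assumes a: "a \<in> Cmp" and Z: "supported_upto p q Z"
  shows "SS Z a =
    (\<Sum>u\<in>incr_upto p (dim_row a). \<Sum>v\<in>incr_upto q (dim_col a). entry_prod Z a u v)"
proof -
  let ?m = "dim_row a" and ?n = "dim_col a"
  have zero: "entry_prod Z a u v = 0"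
    if uv: "u \<in> incr_seqs ?m" "v \<in> incr_seqs ?n" and
      out: "u \<notin> incr_upto p ?m \<or> v \<notin> incr_upto q ?n" for u v
  proof -
    have pos: "1 \<le> u ! s" "1 \<le> v ! t" if "s < ?m" "t < ?n" for s t
      using uv that by (force simp: incr_seqs_def)+
    have "\<exists>s<?m. \<exists>t<?n. a $$ (s, t) \<noteq> {#} \<and> \<not> (u ! s \<le> p \<and> v ! t \<le> q)"
      using out
    proof
      assume "u \<notin> incr_upto p ?m"
      then obtain x where "x \<in> set u" "\<not> x \<le> p"
        using uv by (auto simp: incr_upto_def)
      then obtain s where s: "s < ?m" "\<not> u ! s \<le> p"
        using uv by (auto simp: incr_seqs_def in_set_conv_nth)
      then show ?thesis using a by (metis Cmp_iff)
    next
      assume "v \<notin> incr_upto q ?n"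
      then obtain x where "x \<in> set v" "\<not> x \<le> q"
        using uv by (auto simp: incr_upto_def)
      then obtain t where t: "t < ?n" "\<not> v ! t \<le> q"
        using uv by (auto simp: incr_seqs_def in_set_conv_nth)
      then show ?thesis using a by (metis Cmp_iff)
    qed
    then obtain s t where st: "s < ?m" "t < ?n" "a $$ (s, t) \<noteq> {#}" "\<not> (u ! s \<le> p \<and> v ! t \<le> q)"
      by blast
    then have "Z (u ! s, v ! t) = 0"
      using Z pos by (simp add: supported_upto_def)
    then have "vpow (Z (u ! s, v ! t)) (a $$ (s, t)) = 0"
      using st(3) by (simp add: vpow_zero)
    then show ?thesis unfolding entry_prod_def using st(1,2) by (force simp: prod_zero_iff)
  qed
  have "SS Z a = supp_sum (\<lambda>(u, v). entry_prod Z a u v) (incr_seqs ?m \<times> incr_seqs ?n)"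
    using a by (simp add: SS_def entry_prod_def)
  also have "\<dots> = (\<Sum>(u, v) \<in> incr_upto p ?m \<times> incr_upto q ?n. entry_prod Z a u v)"
  proof (rule supp_sum_eq_sum)
    show "incr_upto p ?m \<times> incr_upto q ?n \<subseteq> incr_seqs ?m \<times> incr_seqs ?n"
      by (auto simp: incr_upto_def)
  qed (use zero in auto)
  finally show ?thesis by (simp add: sum.cartesian_product)
qed

lemma prod_lessThan_add:
  fixes f :: "nat \<Rightarrow> 'a::comm_monoid_mult"
  shows "(\<Prod>s<k + k'. f s) = (\<Prod>s<k. f s) * (\<Prod>s<k'. f (k + s))"
  by (induction k') (simp_all add: mult.assoc)

text \<open>
  Off the diagonal blocks the array is \<open>0\<close>, and evaluation of a multiset at \<open>0\<close> is \<open>1\<close> for the empty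
  multiset and \<open>0\<close> otherwise: the off-diagonal entries of \<open>a\<close> either do not contribute to the product
  or annihilate it.
\<close>

lemma entry_prod_block_sum:
  assumes u: "u \<in> incr_upto p k" "u' \<in> incr_upto p' (dim_row a - k)"
    and v: "v \<in> incr_upto q l" "v' \<in> incr_upto q' (dim_col a - l)"
    and kl: "k \<le> dim_row a" "l \<le> dim_col a"
  shows "entry_prod (block_sum p q A B) a (u @ map (\<lambda>i. p + i) u') (v @ map (\<lambda>i. q + i) v') =
    (if off_diag_empty k l a
     then entry_prod A (upper_left k l a) u v * entry_prod B (lower_right k l a) u' v' else 0)"
proof -
  define Z where "Z = block_sum p q A B"
  define w x where "w = u @ map (\<lambda>i. p + i) u'" and "x = v @ map (\<lambda>i. q + i) v'"
  define e where "e s t = vpow (Z (w ! s, x ! t)) (a $$ (s, t))" for s t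
  let ?m = "dim_row a - k" and ?n = "dim_col a - l"
  have w: "w ! s = u ! s" "1 \<le> w ! s" "w ! s \<le> p" if "s < k" for s
    using incr_upto_nth[OF u(1) that] that length_incr_upto[OF u(1)] by (auto simp: w_def nth_append)
  have w': "w ! (k + s) = p + u' ! s" "1 \<le> u' ! s" if "s < ?m" for s
    using incr_upto_nth[OF u(2) that] that length_incr_upto[OF u(1)] length_incr_upto[OF u(2)]
    by (auto simp: w_def nth_append)
  have x: "x ! t = v ! t" "1 \<le> x ! t" "x ! t \<le> q" if "t < l" for t
    using incr_upto_nth[OF v(1) that] that length_incr_upto[OF v(1)] by (auto simp: x_def nth_append)
  have x': "x ! (l + t) = q + v' ! t" "1 \<le> v' ! t" if "t < ?n" for t
    using incr_upto_nth[OF v(2) that] that length_incr_upto[OF v(1)] length_incr_upto[OF v(2)]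
    by (auto simp: x_def nth_append)
  have Z11: "Z (w ! s, x ! t) = A (u ! s, v ! t)" if "s < k" "t < l" for s t
    using w[OF that(1)] x[OF that(2)] by (simp add: Z_def block_sum_def)
  have Z22: "Z (w ! (k + s), x ! (l + t)) = B (u' ! s, v' ! t)" if "s < ?m" "t < ?n" for s t
    using w'[OF that(1)] x'[OF that(2)] by (simp add: Z_def block_sum_def)
  have Z12: "Z (w ! s, x ! (l + t)) = 0" if "s < k" "t < ?n" for s t
    using w[OF that(1)] x'[OF that(2)] by (simp add: Z_def block_sum_def)
  have Z21: "Z (w ! (k + s), x ! t) = 0" if "s < ?m" "t < l" for s t
    using w'[OF that(1)] x[OF that(2)] by (simp add: Z_def block_sum_def)
  have ep: "entry_prod Z a w x = (\<Prod>s<dim_row a. \<Prod>t<dim_col a. e s t)"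
    by (simp add: entry_prod_def e_def)
  show ?thesis
  proof (cases "off_diag_empty k l a")
    case True
    have e12: "e s (l + t) = 1" if "s < k" "t < ?n" for s t
      using True that kl by (simp add: e_def off_diag_empty_def vpow_hom)
    have e21: "e (k + s) t = 1" if "s < ?m" "t < l" for s t
      using True that kl by (simp add: e_def off_diag_empty_def vpow_hom)
    have "(\<Prod>s<dim_row a. \<Prod>t<dim_col a. e s t) = (\<Prod>s<k + ?m. \<Prod>t<l + ?n. e s t)"
      using kl by simp
    also have "\<dots> = (\<Prod>s<k. (\<Prod>t<l. e s t) * (\<Prod>t<?n. e s (l + t))) *
        (\<Prod>s<?m. (\<Prod>t<l. e (k + s) t) * (\<Prod>t<?n. e (k + s) (l + t)))"
      by (simp only: prod_lessThan_add)
    also have "\<dots> = (\<Prod>s<k. \<Prod>t<l. e s t) * (\<Prod>s<?m. \<Prod>t<?n. e (k + s) (l + t))"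
      by (simp add: e12 e21)
    also have "(\<Prod>s<k. \<Prod>t<l. e s t) = entry_prod A (upper_left k l a) u v"
      by (simp add: entry_prod_def e_def Z11 upper_left_def)
    also have "(\<Prod>s<?m. \<Prod>t<?n. e (k + s) (l + t)) = entry_prod B (lower_right k l a) u' v'"
      by (simp add: entry_prod_def e_def Z22 lower_right_def)
    finally show ?thesis using True ep by (simp add: Z_def w_def x_def)
  next
    case False
    then obtain s t where st: "s < dim_row a" "t < dim_col a" "(s < k) \<noteq> (t < l)"
      "a $$ (s, t) \<noteq> {#}"
      using kl by (auto simp: off_diag_empty_def)
    have "Z (w ! s, x ! t) = 0"
    proof (cases "s < k")
      case True
      then show ?thesis using Z12[of s "t - l"] st by simp
    next
      case False
      then show ?thesis using Z21[of "s - k" t] st by simp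
    qed
    then have "e s t = 0" using st(4) by (simp add: e_def vpow_zero)
    then have "(\<Prod>s<dim_row a. \<Prod>t<dim_col a. e s t) = 0"
      using st(1,2) by (force simp: prod_zero_iff)
    then show ?thesis using False ep by (simp add: Z_def w_def x_def)
  qed
qed

lemma block_sum_supported_upto:
  assumes "supported_upto p' q' B"
  shows "supported_upto (p + p') (q + q') (block_sum p q A B)"
  unfolding supported_upto_def
proof (intro allI impI)
  fix i j :: nat
  assume ij: "1 \<le> i" "1 \<le> j" "\<not> (i \<le> p + p' \<and> j \<le> q + q')"
  have "B (i - p, j - q) = 0" if "p < i" "q < j"
  proof -
    have "1 \<le> i - p" "1 \<le> j - q" "\<not> (i - p \<le> p' \<and> j - q \<le> q')"
      using ij that by auto
    then show ?thesis using assms unfolding supported_upto_def by blast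
  qed
  then show "block_sum p q A B (i, j) = 0"
    using ij by (auto simp: block_sum_def)
qed

lemma SS_block_sum:
  assumes A: "supported_upto p q A" and B: "supported_upto p' q' B"
  shows "SS (block_sum p q A B) = SS A \<bullet>\<^sub>C SS B"
proof
  fix a :: "'b multiset Matrix.mat"
  show "SS (block_sum p q A B) a = (SS A \<bullet>\<^sub>C SS B) a"
  proof (cases "a \<in> Cmp")
    case False
    then show ?thesis by (simp add: SS_def cmp_mult_def)
  next
    case True
    let ?m = "dim_row a" and ?n = "dim_col a"
    let ?Z = "block_sum p q A B"
    \<comment> \<open>the contribution of all index sequences cut after \<open>k\<close> row and \<open>l\<close> column indices\<close>
    define T where "T k l = (if off_diag_empty k l a
      then SS A (upper_left k l a) * SS B (lower_right k l a) else 0)" for k l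
    have T: "(\<Sum>u\<in>incr_upto p k. \<Sum>u'\<in>incr_upto p' (?m - k).
          \<Sum>v\<in>incr_upto q l. \<Sum>v'\<in>incr_upto q' (?n - l).
            entry_prod ?Z a (u @ map (\<lambda>i. p + i) u') (v @ map (\<lambda>i. q + i) v')) = T k l"
      (is "?L = _") if kl: "k \<le> ?m" "l \<le> ?n" for k l
    proof -
      have "?L = (\<Sum>u\<in>incr_upto p k. \<Sum>u'\<in>incr_upto p' (?m - k).
          \<Sum>v\<in>incr_upto q l. \<Sum>v'\<in>incr_upto q' (?n - l). if off_diag_empty k l a
     then entry_prod A (upper_left k l a) u v * entry_prod B (lower_right k l a) u' v' else 0)"
        by (intro sum.cong refl entry_prod_block_sum kl)
      also have "\<dots> = T k l"
      proof (cases "off_diag_empty k l a")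
        case D: True
        note Cmp = blocks_in_Cmp[OF True D]
        have "T k l = (\<Sum>u\<in>incr_upto p k. \<Sum>v\<in>incr_upto q l. entry_prod A (upper_left k l a) u v) *
           (\<Sum>u'\<in>incr_upto p' (?m - k). \<Sum>v'\<in>incr_upto q' (?n - l).
              entry_prod B (lower_right k l a) u' v')"
          using D by (simp add: T_def SS_eq_finite_sum[OF Cmp(1) A] SS_eq_finite_sum[OF Cmp(2) B])
        also have "\<dots> = (\<Sum>u\<in>incr_upto p k. \<Sum>u'\<in>incr_upto p' (?m - k).
          \<Sum>v\<in>incr_upto q l. \<Sum>v'\<in>incr_upto q' (?n - l).
          entry_prod A (upper_left k l a) u v * entry_prod B (lower_right k l a) u' v')"
          by (simp only: sum_product)
        finally show ?thesis using D by simp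
      qed (simp add: T_def)
      finally show ?thesis .
    qed
    have "SS ?Z a = (\<Sum>w\<in>incr_upto (p + p') ?m. \<Sum>x\<in>incr_upto (q + q') ?n. entry_prod ?Z a w x)"
      by (rule SS_eq_finite_sum[OF True block_sum_supported_upto[OF B]])
    also have "\<dots> = (\<Sum>k\<le>?m. \<Sum>u\<in>incr_upto p k. \<Sum>u'\<in>incr_upto p' (?m - k). \<Sum>l\<le>?n.
          \<Sum>v\<in>incr_upto q l. \<Sum>v'\<in>incr_upto q' (?n - l).
            entry_prod ?Z a (u @ map (\<lambda>i. p + i) u') (v @ map (\<lambda>i. q + i) v'))"
      by (simp only: sum_incr_upto_split)
    also have "\<dots> = (\<Sum>k\<le>?m. \<Sum>l\<le>?n. \<Sum>u\<in>incr_upto p k. \<Sum>u'\<in>incr_upto p' (?m - k).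
          \<Sum>v\<in>incr_upto q l. \<Sum>v'\<in>incr_upto q' (?n - l).
            entry_prod ?Z a (u @ map (\<lambda>i. p + i) u') (v @ map (\<lambda>i. q + i) v'))"
      by (simp only: sum.swap[where B = "{..?n}"])
    also have "\<dots> = (\<Sum>k\<le>?m. \<Sum>l\<le>?n. T k l)"
      by (intro sum.cong refl T) auto
    also have "\<dots> = (\<Sum>(k, l) \<in> {..?m} \<times> {..?n}. T k l)"
      by (simp add: sum.cartesian_product)
    also have "\<dots> = (\<Sum>(k, l) \<in> {(k, l). off_diag_empty k l a}. T k l)"
    proof (rule sum.mono_neutral_right)
      show "{(k, l). off_diag_empty k l a} \<subseteq> {..?m} \<times> {..?n}"
        by (auto simp: off_diag_empty_def)
      show "\<forall>x \<in> {..?m} \<times> {..?n} - {(k, l). off_diag_empty k l a}. (case x of (k, l) \<Rightarrow> T k l) = 0"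
        by (auto simp: T_def split: if_splits)
    qed simp
    also have "\<dots> = (\<Sum>(k, l) \<in> {(k, l). off_diag_empty k l a}.
        SS A (upper_left k l a) * SS B (lower_right k l a))"
      by (intro sum.cong refl) (auto simp: T_def)
    also have "\<dots> = (SS A \<bullet>\<^sub>C SS B) a"
      by (rule cmp_mult_eq_sum_blocks[OF True, symmetric])
    finally show ?thesis .
  qed
qed

theorem corollary2p37:
  fixes X Y :: "nat \<times> nat \<Rightarrow> 'a::idom ^ 'd::finite"
  assumes "X \<in> evC" and "Y \<in> evC"
  shows "SS (\<delta> (X \<box> Y)) = SS (\<delta> X) \<bullet>\<^sub>C SS (\<delta> Y)"
  unfolding diff_op_diag_concat[OF assms(1)]
  by (rule SS_block_sum[OF diff_op_supported_upto[OF assms(1)] diff_op_supported_upto[OF assms(2)]])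

end
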